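(* Let $D$ be the multipole Darboux matrix in symmetric form $$D(\lambda)=\mathcal N\Big(I+\sum_{k=1}^N\sum_{j=1}^N\frac{b_jK_{jk}a_k}{\lambda-\lambda_k}\Big)$$ described in the context, let $\tilde\Psi=D\Psi$, and let $F=\Psi^{-1}\Psi,_\zeta$ and $\tilde F=\tilde\Psi^{-1}\tilde\Psi,_\zeta$ be the associated soliton surfaces. Then $$\tilde F=F-\lambda,_\zeta\sum_{j=1}^N\sum_{k=1}^N\frac{\Psi^{-1}(\lambda)\,b_j\,K_{jk}\,a_k\,\Psi(\lambda)}{(\lambda-\lambda_k)(\lambda-\mu_j)} .$$
   Context: Let $x=(x^1,\dots,x^m)$. $\Psi=\Psi(x,\lambda)$ is an invertible $n\times n$ matrix solution of a linear problem $\Psi,_\nu=U_\nu\Psi$ ($\nu=1,\dots,m$), where $U_\nu=U_\nu(x,\lambda)$ is rational in $\lambda$ and $,_\nu$ denotes the derivative with respect to $x^\nu$. The spectral parameter is either constant ($\lambda=\zeta$, isospectral case) or satisfies $\lambda,_\nu=L_\nu(x,\lambda)$ with given $L_\nu$ rational in $\lambda$ (nonisospectral case); in the latter case $\lambda=\Lambda(x,\zeta)$ is the solution depending on a constant of integration $\zeta$. The subscript $,_\zeta$ denotes the derivative with respect to $\zeta$ at fixed $x$, so that $D,_\zeta=\lambda,_\zeta\,\partial D/\partial\lambda$. Symmetric form of the Darboux matrix: $\lambda_1,\dots,\lambda_N,\mu_1,\dots,\mu_N$ are pairwise different and independent of $\zeta$; each is constant in the isospectral case and satisfies the same equations as $\lambda$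 (i.e. $\lambda_k,_\nu=L_\nu(x,\lambda_k)$, $\mu_k,_\nu=L_\nu(x,\mu_k)$) in the nonisospectral case. $\Psi$ is regular and invertible at $\lambda_k,\mu_k$. For each $k$, $a_k=a_{k0}\Psi^{-1}(x,\lambda_k)$ and $b_k=\Psi(x,\mu_k)b_{k0}$, where $a_{k0}$ is a constant matrix with $n$ columns and linearly independent rows, and $b_{k0}$ is a constant matrix with $n$ rows and linearly independent columns (the numbers of rows of $a_{k0}$, resp. columns of $b_{k0}$, may depend on $k$). $\hat M$ is the block matrix with blocks $M_{kj}=\dfrac{a_kb_j}{\lambda_k-\mu_j}$; it is assumed to be square and invertible, and $K_{jk}$ denotes the corresponding blocks of $\hat K=\hat M^{-1}$. $\mathcal N=\mathcal N(x)$ is an invertible, $\lambda$-independent matrix. The inverse of $D$ is $D^{-1}(\lambda)=\big(I-\sum_{j,k}\frac{b_jK_{jk}a_k}{\lambda-\mu_j}\big)\mathcal N^{-1}$. *)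

theory Defs
  imports
    "HOL-Analysis.Analysis"
    "Jordan_Normal_Form.Gauss_Jordan_Elimination"
    "Jordan_Normal_Form.VS_Connect"
begin

text \<open>Matrices are those of Jordan Normal Form (\<open>complex mat\<close>, with dimensions given by natural
  numbers), since the block sizes depend on an index. The space variables form a vector of
  \<open>real ^ 'm\<close>.\<close>

abbreviation mat_inv :: "complex mat \<Rightarrow> complex mat" where
  "mat_inv A \<equiv> the (mat_inverse A)"

text \<open>Matrices of varying size do not form an additive monoid type, so sums of
  \<open>n \<times> n\<close> matrices are taken entrywise.\<close>

definition sum_mats :: "nat \<Rightarrow> ('i \<Rightarrow> complex mat) \<Rightarrow> 'i set \<Rightarrow> complex mat" where
  "sum_mats n f I = Matrix.mat n n (\<lambda>(r, c). \<Sum>i\<in>I. f i $$ (r, c))"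

definition deriv_mat :: "nat \<Rightarrow> (complex \<Rightarrow> complex mat) \<Rightarrow> complex \<Rightarrow> complex mat" where
  "deriv_mat n f z = Matrix.mat n n (\<lambda>(r, c). deriv (\<lambda>w. f w $$ (r, c)) z)"

definition has_partial_derivative ::
    "(real ^ 'm \<Rightarrow> complex) \<Rightarrow> 'm::finite \<Rightarrow> complex \<Rightarrow> real ^ 'm \<Rightarrow> bool" where
  "has_partial_derivative f \<nu> d x \<longleftrightarrow>
     ((\<lambda>t::real. f (x + t *\<^sub>R axis \<nu> 1)) has_vector_derivative d) (at 0)"

text \<open>A rational function without poles in \<open>S\<close>.\<close>

definition rational_on :: "(complex \<Rightarrow> complex) \<Rightarrow> complex set \<Rightarrow> bool" where
  "rational_on f S \<longleftrightarrow> (\<exists>p q :: complex poly. q \<noteq> 0 \<and>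
     (\<forall>z\<in>S. poly q z \<noteq> 0 \<and> f z = poly p z / poly q z))"

text \<open>The admissible spectral parameters as functions of \<open>x\<close>: constants in the isospectral case
  (where \<open>L\<close> plays no role), solutions of \<open>l,\<^sub>\<nu> = L\<^sub>\<nu>(x, l)\<close> in the nonisospectral case.\<close>

definition spectral_parameter ::
    "bool \<Rightarrow> ('m::finite \<Rightarrow> real ^ 'm \<Rightarrow> complex \<Rightarrow> complex) \<Rightarrow> (real ^ 'm) set
       \<Rightarrow> (real ^ 'm \<Rightarrow> complex) \<Rightarrow> bool" where
  "spectral_parameter isospectral L X l \<longleftrightarrow>
     (if isospectral then l constant_on X
      else \<forall>x\<in>X. \<forall>\<nu>. has_partial_derivative l \<nu> (L \<nu> x (l x)) x)"

text \<open>\<open>\<Psi>,\<^sub>\<nu> = U\<^sub>\<nu> \<Psi>\<close>. The derivative is the total one: \<open>\<lambda>\<close> is replaced by a spectral parameter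
  before differentiating with respect to \<open>x\<^sup>\<nu>\<close>.\<close>

definition linear_problem ::
    "nat \<Rightarrow> bool \<Rightarrow> ('m::finite \<Rightarrow> real ^ 'm \<Rightarrow> complex \<Rightarrow> complex) \<Rightarrow> (real ^ 'm) set
       \<Rightarrow> ((real ^ 'm) \<times> complex) set \<Rightarrow> ('m \<Rightarrow> real ^ 'm \<Rightarrow> complex \<Rightarrow> complex mat)
       \<Rightarrow> (real ^ 'm \<Rightarrow> complex \<Rightarrow> complex mat) \<Rightarrow> bool" where
  "linear_problem n isospectral L X \<Omega> U \<Psi> \<longleftrightarrow>
     (\<forall>l. spectral_parameter isospectral L X l \<and> (\<forall>x\<in>X. (x, l x) \<in> \<Omega>) \<longrightarrow>
        (\<forall>x\<in>X. \<forall>\<nu>. \<forall>r<n. \<forall>c<n.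
           has_partial_derivative (\<lambda>y. \<Psi> y (l y) $$ (r, c)) \<nu>
             ((U \<nu> x (l x) * \<Psi> x (l x)) $$ (r, c)) x))"

definition lin_indep_rows :: "complex mat \<Rightarrow> bool" where
  "lin_indep_rows A \<longleftrightarrow> distinct (Matrix.rows A) \<and>
     \<not> LinearCombinations.module.lin_dep class_ring (module_vec TYPE(complex) (dim_col A))
         (set (Matrix.rows A))"

definition lin_indep_cols :: "complex mat \<Rightarrow> bool" where
  "lin_indep_cols A \<longleftrightarrow> distinct (cols A) \<and>
     \<not> LinearCombinations.module.lin_dep class_ring (module_vec TYPE(complex) (dim_row A))
         (set (cols A))"

text \<open>Block matrices: \<open>p k\<close> is the height of the \<open>k\<close>-th block row and \<open>q j\<close> the width of the
  \<open>j\<close>-th block column; a block matrix of \<open>N \<times> N\<close> blocks has \<open>block_offset p N\<close> rows and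
  \<open>block_offset q N\<close> columns.\<close>

definition block_offset :: "(nat \<Rightarrow> nat) \<Rightarrow> nat \<Rightarrow> nat" where
  "block_offset p k = (\<Sum>i<k. p i)"

text \<open>The number of the block containing the global index \<open>r\<close>.\<close>

definition block_index :: "(nat \<Rightarrow> nat) \<Rightarrow> nat \<Rightarrow> nat" where
  "block_index p r = (LEAST k. r < block_offset p (Suc k))"

definition block_mat ::
    "nat \<Rightarrow> (nat \<Rightarrow> nat) \<Rightarrow> (nat \<Rightarrow> nat) \<Rightarrow> (nat \<Rightarrow> nat \<Rightarrow> complex mat) \<Rightarrow> complex mat" where
  "block_mat N p q B = Matrix.mat (block_offset p N) (block_offset q N)
     (\<lambda>(r, c). B (block_index p r) (block_index q c) $$
        (r - block_offset p (block_index p r), c - block_offset q (block_index q c)))"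

definition block_of ::
    "(nat \<Rightarrow> nat) \<Rightarrow> (nat \<Rightarrow> nat) \<Rightarrow> complex mat \<Rightarrow> nat \<Rightarrow> nat \<Rightarrow> complex mat" where
  "block_of p q A k j = Matrix.mat (p k) (q j)
     (\<lambda>(r, c). A $$ (block_offset p k + r, block_offset q j + c))"

end

theory Submission
  imports Defs
begin

text \<open>Stack the \<open>a\<^sub>k\<close> into a column \<open>A\<close> and the \<open>b\<^sub>j\<close> into a row \<open>B\<close>, and let \<open>S\<close>, \<open>T\<close> be the
  block-scalar matrices with blocks \<open>\<lambda> - \<mu>\<^sub>j\<close> and \<open>\<lambda> - \<lambda>\<^sub>k\<close>. The definition of \<open>M\<close> then says
  \<open>M S - T M = A B\<close>, so \<open>K = M\<^sup>-\<^sup>1\<close> satisfies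
  \<open>K T\<^sup>-\<^sup>1 - S\<^sup>-\<^sup>1 K = S\<^sup>-\<^sup>1 K A B K T\<^sup>-\<^sup>1\<close>. For \<open>D = N (I + B K T\<^sup>-\<^sup>1 A)\<close> this yields
  both \<open>D\<^sup>-\<^sup>1 = (I - B S\<^sup>-\<^sup>1 K A) N\<^sup>-\<^sup>1\<close> and
  \<open>D\<^sup>-\<^sup>1 \<partial>D/\<partial>\<lambda> = - B S\<^sup>-\<^sup>1 K T\<^sup>-\<^sup>1 A\<close>. It remains to conjugate by \<open>\<Psi>\<close>, since
  the product rule gives \<open>F\<^sub>n\<^sub>e\<^sub>w = F + \<Psi>\<^sup>-\<^sup>1 D\<^sup>-\<^sup>1 D,\<^sub>\<zeta> \<Psi>\<close> for the new surface.\<close>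

section \<open>Matrix algebra with side conditions on dimensions, and inverses\<close>

lemma mult_mat_assoc_dim:
  assumes "dim_col A = dim_row B" "dim_col B = dim_row C"
  shows "A * B * C = A * (B * C :: 'a :: semiring_0 mat)"
  using assms by (intro assoc_mult_mat) auto

lemma mult_mat_add_distrib_dim:
  assumes "dim_col A = dim_row B" "dim_row B = dim_row C" "dim_col B = dim_col C"
  shows "A * (B + C) = A * B + A * (C :: 'a :: semiring_0 mat)"
  using assms by (intro mult_add_distrib_mat) auto

lemma add_mat_mult_distrib_dim:
  assumes "dim_row A = dim_row B" "dim_col A = dim_col B" "dim_col A = dim_row C"
  shows "(A + B) * C = A * C + B * (C :: 'a :: semiring_0 mat)"
  using assms by (intro add_mult_distrib_mat) auto

lemma minus_mat_mult_distrib_dim: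
  assumes "dim_row A = dim_row B" "dim_col A = dim_col B" "dim_col A = dim_row C"
  shows "(A - B) * C = A * C - B * (C :: 'a :: ring mat)"
  using assms by (intro minus_mult_distrib_mat) auto

lemma mult_smult_mat_dim:
  assumes "dim_col A = dim_row B"
  shows "A * (k \<cdot>\<^sub>m B) = k \<cdot>\<^sub>m (A * (B :: 'a :: comm_semiring_0 mat))"
  using assms by (intro mult_smult_distrib) auto

lemma smult_mult_mat_dim:
  assumes "dim_col A = dim_row B"
  shows "(k \<cdot>\<^sub>m A) * B = k \<cdot>\<^sub>m (A * (B :: 'a :: comm_semiring_0 mat))"
  using assms by (intro mult_smult_assoc_mat) auto

lemma one_mult_mat_dim: "n = dim_row A \<Longrightarrow> 1\<^sub>m n * A = (A :: 'a :: semiring_1 mat)"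
  by (intro left_mult_one_mat) auto

lemma mult_one_mat_dim: "n = dim_col A \<Longrightarrow> A * 1\<^sub>m n = (A :: 'a :: semiring_1 mat)"
  by (intro right_mult_one_mat) auto

text \<open>The side conditions are equations between dimensions, without the free carrier sizes of
  the library versions, so the simplifier can discharge them. Used as rewrite rules they expand an
  expression into a sum of right-nested products.\<close>

lemmas mat_ring_dim = mult_mat_assoc_dim mult_mat_add_distrib_dim add_mat_mult_distrib_dim
  minus_mat_mult_distrib_dim mult_smult_mat_dim smult_mult_mat_dim
  one_mult_mat_dim mult_one_mat_dim

text \<open>\<open>mat_inverse\<close> returns an option. A two-sided inverse makes \<open>A\<close>
  a unit of the matrix ring, which rules out \<open>None\<close>.\<close>

lemma mat_inv_works:
  assumes "A \<in> carrier_mat n n" "invertible_mat A"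
  shows "mat_inv A \<in> carrier_mat n n" "A * mat_inv A = 1\<^sub>m n" "mat_inv A * A = 1\<^sub>m n"
proof -
  obtain B where B: "A * B = 1\<^sub>m (dim_row A)" "B * A = 1\<^sub>m (dim_row B)"
    using assms(2) by (auto simp: invertible_mat_def inverts_mat_def)
  \<comment> \<open>\<open>inverts_mat\<close> does not fix the size of \<open>B\<close>; comparing
    dimensions in the two products does.\<close>
  have "dim_row B = n" "dim_col B = n"
    using assms(1) B by (metis carrier_matD index_mult_mat(2,3) index_one_mat(2,3))+
  then have "A \<in> Units (ring_mat TYPE(complex) n ())"
    using B assms(1) by (auto simp: Units_def ring_mat_simps intro!: bexI[of _ B])
  then obtain C where C: "mat_inverse A = Some C"
    using mat_inverse(1)[OF assms(1), where b = "()"] by (cases "mat_inverse A") auto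
  from mat_inverse(2)[OF assms(1) C] show "mat_inv A \<in> carrier_mat n n"
    "A * mat_inv A = 1\<^sub>m n" "mat_inv A * A = 1\<^sub>m n"
    by (simp_all add: C)
qed

text \<open>A left inverse of a square matrix is also a right inverse, and inverses are unique. An
  inverse can thus be identified by computing a single product.\<close>

lemma mat_inv_eqI:
  assumes "A \<in> carrier_mat n n" "B \<in> carrier_mat n n" "B * A = 1\<^sub>m n"
  shows "mat_inv A = B"
proof -
  have AB: "A * B = 1\<^sub>m n"
    using mat_mult_left_right_inverse[OF assms(2,1,3)] .
  have "invertible_mat A"
    using assms AB unfolding invertible_mat_def inverts_mat_def by auto
  note inv = mat_inv_works[OF assms(1) this]
  have "mat_inv A = (B * A) * mat_inv A"
    using inv assms by simp
  also have "\<dots> = B * (A * mat_inv A)"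
    using inv assms by (intro assoc_mult_mat)
  also have "\<dots> = B"
    unfolding inv(2) using assms by simp
  finally show ?thesis .
qed

section \<open>Global indices as pairs of a block number and a local index\<close>

lemma block_offset_Suc: "block_offset p (Suc k) = block_offset p k + p k"
  by (simp add: block_offset_def)

lemma block_offset_mono: "j \<le> k \<Longrightarrow> block_offset p j \<le> block_offset p k"
  unfolding block_offset_def by (rule sum_mono2) auto

lemma block_index_offset:
  assumes "r < p k"
  shows "block_index p (block_offset p k + r) = k"
  unfolding block_index_def
proof (rule Least_equality)
  fix j assume "block_offset p k + r < block_offset p (Suc j)"
  then have "\<not> block_offset p (Suc j) \<le> block_offset p k" by simp
  then show "k \<le> j" using block_offset_mono[of "Suc j" k p] by linarith
qed (use assms in \<open>simp add: block_offset_Suc\<close>)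

text \<open>Converse of \<open>block_index_offset\<close>: every global index decomposes. Empty
  blocks are skipped, since the least block whose end exceeds \<open>r\<close> has positive
  size.\<close>

lemma block_index_bounds:
  assumes "r < block_offset p N"
  shows "block_index p r < N" "r - block_offset p (block_index p r) < p (block_index p r)"
proof -
  obtain N' where N: "N = Suc N'"
    using assms by (cases N) (auto simp: block_offset_def)
  let ?k = "block_index p r"
  have up: "r < block_offset p (Suc ?k)" and "?k \<le> N'"
    using assms unfolding block_index_def N by (auto intro: LeastI Least_le)
  then show "?k < N" using N by simp
  \<comment> \<open>By minimality the preceding block ends at or before \<open>r\<close>; block 0
    starts at 0.\<close>
  have "block_offset p ?k \<le> r"
  proof (cases ?k)
    case (Suc k)
    then have "\<not> r < block_offset p (Suc k)"
      using not_less_Least[of k "\<lambda>k. r < block_offset p (Suc k)"] unfolding block_index_def by simp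
    then show ?thesis using Suc by simp
  qed (simp add: block_offset_def)
  then show "r - block_offset p ?k < p ?k"
    using up by (simp add: block_offset_Suc)
qed

lemma sum_block_offset:
  fixes f :: "nat \<Rightarrow> 'a :: comm_monoid_add"
  shows "(\<Sum>s<block_offset p N. f s) = (\<Sum>k<N. \<Sum>r<p k. f (block_offset p k + r))"
proof (induction N)
  case (Suc N)
  have "(\<Sum>s<m + l. f s) = (\<Sum>s<m. f s) + (\<Sum>r<l. f (m + r))" for m l
    by (induction l) (simp_all add: add.assoc)
  then show ?case using Suc by (simp add: block_offset_Suc)
qed (simp add: block_offset_def)

section \<open>Double sums over blocks as products of ordinary matrices\<close>

definition block_col :: "nat \<Rightarrow> (nat \<Rightarrow> nat) \<Rightarrow> nat \<Rightarrow> (nat \<Rightarrow> complex mat) \<Rightarrow> complex mat" where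
  "block_col N p n a = Matrix.mat (block_offset p N) n
     (\<lambda>(t, c). a (block_index p t) $$ (t - block_offset p (block_index p t), c))"

definition block_row :: "nat \<Rightarrow> nat \<Rightarrow> (nat \<Rightarrow> nat) \<Rightarrow> (nat \<Rightarrow> complex mat) \<Rightarrow> complex mat" where
  "block_row n N q b = Matrix.mat n (block_offset q N)
     (\<lambda>(r, s). b (block_index q s) $$ (r, s - block_offset q (block_index q s)))"

text \<open>Encodes the block-scalar matrices: the \<open>k\<close>-th diagonal block is
  \<open>f k\<close> times the identity of size \<open>p k\<close>.\<close>

definition block_diag :: "nat \<Rightarrow> (nat \<Rightarrow> nat) \<Rightarrow> (nat \<Rightarrow> complex) \<Rightarrow> complex mat" where
  "block_diag N p f = mat_diag (block_offset p N) (\<lambda>s. f (block_index p s))"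

lemma block_carrier [simp]:
  "block_col N p n a \<in> carrier_mat (block_offset p N) n"
  "block_row n N q b \<in> carrier_mat n (block_offset q N)"
  "block_diag N p f \<in> carrier_mat (block_offset p N) (block_offset p N)"
  "block_mat N p q C \<in> carrier_mat (block_offset p N) (block_offset q N)"
  by (simp_all add: block_col_def block_row_def block_diag_def block_mat_def mat_diag_def)

lemmas block_dim [simp] = block_carrier[THEN carrier_matD(1)] block_carrier[THEN carrier_matD(2)]

lemma block_diag_mult:
  "block_diag N p f * block_diag N p g = block_diag N p (\<lambda>k. f k * g k)"
  by (simp add: block_diag_def)

lemma block_diag_inverse:
  assumes "\<And>k. k < N \<Longrightarrow> f k * g k = 1"
  shows "block_diag N p f * block_diag N p g = 1\<^sub>m (block_offset p N)"
  unfolding block_diag_mult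
  by (rule eq_matI) (auto simp: block_diag_def mat_diag_def assms block_index_bounds)

lemma mult_mat_index_sum:
  assumes "A \<in> carrier_mat nr n" "B \<in> carrier_mat n nc" "r < nr" "c < nc"
  shows "(A * B) $$ (r, c) = (\<Sum>i<n. A $$ (r, i) * B $$ (i, c))"
  using assms by (auto simp: scalar_prod_def lessThan_atLeast0 intro!: sum.cong)

lemma mult3_mat_index_sum:
  assumes "A \<in> carrier_mat nr n" "B \<in> carrier_mat n m" "C \<in> carrier_mat m nc" "r < nr" "c < nc"
  shows "(A * B * C) $$ (r, c) = (\<Sum>u<n. \<Sum>v<m. A $$ (r, u) * B $$ (u, v) * C $$ (v, c))"
proof -
  have "(A * B * C) $$ (r, c) = (\<Sum>v<m. (\<Sum>u<n. A $$ (r, u) * B $$ (u, v)) * C $$ (v, c))"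
    using assms by (subst mult_mat_index_sum[of "A * B" nr m C nc])
      (auto simp: mult_mat_index_sum[of A nr n B m] simp del: index_mult_mat(1) assoc_mult_mat)
  then show ?thesis
    by (simp add: sum_distrib_right sum.swap[of _ "{..<m}"])
qed

text \<open>The weight of the pair (j, k) factors as \<open>g j * f k\<close>, so the two factors
  can be absorbed into diagonal matrices scaling the rows and the columns of \<open>K\<close>. This
  translates the sums of the theorem into block algebra and back.\<close>

lemma sum_mats_blocks:
  assumes b: "\<And>j. j < N \<Longrightarrow> b j \<in> carrier_mat n (q j)"
    and a: "\<And>k. k < N \<Longrightarrow> a k \<in> carrier_mat (p k) n"
    and K: "K \<in> carrier_mat (block_offset q N) (block_offset p N)"
  shows "sum_mats n (\<lambda>(j, k). (g j * f k) \<cdot>\<^sub>m (b j * block_of q p K j k * a k)) ({..<N} \<times> {..<N}) =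
    block_row n N q b * (block_diag N q g * K * block_diag N p f) * block_col N p n a"
    (is "?L = ?R")
proof (rule eq_matI)
  have dim: "dim_row ?R = n" "dim_col ?R = n"
    by (simp_all add: block_row_def block_col_def)
  show "dim_row ?L = dim_row ?R" "dim_col ?L = dim_col ?R"
    by (simp_all add: sum_mats_def dim)
  fix r c assume "r < dim_row ?R" "c < dim_col ?R"
  then have rc: "r < n" "c < n" by (simp_all only: dim)
  have K': "block_diag N q g * K * block_diag N p f = Matrix.mat (block_offset q N) (block_offset p N)
      (\<lambda>(s, t). g (block_index q s) * K $$ (s, t) * f (block_index p t))"
    using K by (subst block_diag_def, subst mat_diag_mult_left[of _ _ "block_offset p N"])
      (auto simp: block_diag_def mat_diag_mult_right[of _ "block_offset q N"])
  have "?R $$ (r, c) = (\<Sum>s<block_offset q N. \<Sum>t<block_offset p N. block_row n N q b $$ (r, s) *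
      (g (block_index q s) * K $$ (s, t) * f (block_index p t)) * block_col N p n a $$ (t, c))"
    unfolding K' by (subst mult3_mat_index_sum[OF block_carrier(2) _ block_carrier(1) rc]) auto
  also have "\<dots> = (\<Sum>j<N. \<Sum>u<q j. \<Sum>k<N. \<Sum>v<p k.
      b j $$ (r, u) * (g j * K $$ (block_offset q j + u, block_offset p k + v) * f k) * a k $$ (v, c))"
  proof -
    have "block_offset p k + v < block_offset p N" if "k < N" "v < p k" for p k v
      using block_offset_mono[of "Suc k" N p] that by (simp add: block_offset_Suc)
    then show ?thesis
      unfolding sum_block_offset
      by (intro sum.cong refl) (simp add: block_index_offset block_row_def block_col_def rc)
  qed
  \<comment> \<open>Exchanging the middle sums collects the terms of each pair of blocks; the inner
    double sum is then one entry of a triple product.\<close>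
  also have "\<dots> = (\<Sum>j<N. \<Sum>k<N. \<Sum>u<q j. \<Sum>v<p k.
      b j $$ (r, u) * (g j * K $$ (block_offset q j + u, block_offset p k + v) * f k) * a k $$ (v, c))"
    by (intro sum.cong refl sum.swap)
  also have "\<dots> = (\<Sum>j<N. \<Sum>k<N. g j * f k * (b j * block_of q p K j k * a k) $$ (r, c))"
  proof (intro sum.cong refl)
    fix j k assume "j \<in> {..<N}" "k \<in> {..<N}"
    then have jk: "j < N" "k < N" by simp_all
    have "block_of q p K j k \<in> carrier_mat (q j) (p k)" by (simp add: block_of_def)
    from mult3_mat_index_sum[OF b[OF jk(1)] this a[OF jk(2)] rc]
    show "(\<Sum>u<q j. \<Sum>v<p k.
        b j $$ (r, u) * (g j * K $$ (block_offset q j + u, block_offset p k + v) * f k) * a k $$ (v, c))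
      = g j * f k * (b j * block_of q p K j k * a k) $$ (r, c)"
      by (simp add: sum_distrib_left block_of_def mult_ac del: index_mult_mat(1))
  qed
  also have "\<dots> = ?L $$ (r, c)"
  proof -
    have "dim_row (b j * block_of q p K j k * a k) = n" "dim_col (b j * block_of q p K j k * a k) = n"
      if "j < N" "k < N" for j k
      using a[OF that(2)] b[OF that(1)] by auto
    then show ?thesis
      using rc by (auto simp: sum_mats_def sum.cartesian_product simp del: index_mult_mat(1)
        intro!: sum.cong)
  qed
  finally show "?L $$ (r, c) = ?R $$ (r, c)" by simp
qed

section \<open>The displacement equation and the algebra of the Darboux matrix\<close>

lemma block_displacement:
  assumes b: "\<And>j. j < N \<Longrightarrow> b j \<in> carrier_mat n (q j)"
    and a: "\<And>k. k < N \<Longrightarrow> a k \<in> carrier_mat (p k) n"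
    and ne: "\<And>k j. k < N \<Longrightarrow> j < N \<Longrightarrow> x k \<noteq> y j"
  defines "M \<equiv> block_mat N p q (\<lambda>k j. (1 / (x k - y j)) \<cdot>\<^sub>m (a k * b j))"
  shows "M * block_diag N q (\<lambda>j. l - y j) =
    block_diag N p (\<lambda>k. l - x k) * M + block_col N p n a * block_row n N q b"
proof -
  have M: "M \<in> carrier_mat (block_offset p N) (block_offset q N)" by (simp add: M_def)
  have L: "M * block_diag N q (\<lambda>j. l - y j) = Matrix.mat (block_offset p N) (block_offset q N)
      (\<lambda>(s, t). M $$ (s, t) * (l - y (block_index q t)))"
    using M by (simp add: block_diag_def mat_diag_mult_right[of _ "block_offset p N"])
  have R: "block_diag N p (\<lambda>k. l - x k) * M = Matrix.mat (block_offset p N) (block_offset q N)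
      (\<lambda>(s, t). (l - x (block_index p s)) * M $$ (s, t))"
    using M by (simp add: block_diag_def mat_diag_mult_left[of _ _ "block_offset q N"])
  show ?thesis
    unfolding L R
  proof (rule eq_matI, goal_cases)
    case (1 s t)
    then have st: "s < block_offset p N" "t < block_offset q N"
      by (simp_all add: block_col_def block_row_def)
    let ?k = "block_index p s" and ?j = "block_index q t"
    let ?u = "s - block_offset p ?k" and ?v = "t - block_offset q ?j"
    note kj = block_index_bounds[OF st(1)] block_index_bounds[OF st(2)]
    have dims: "a ?k \<in> carrier_mat (p ?k) n" "b ?j \<in> carrier_mat n (q ?j)" using a b kj by auto
    have "(block_col N p n a * block_row n N q b) $$ (s, t) = (a ?k * b ?j) $$ (?u, ?v)"
      unfolding mult_mat_index_sum[OF block_carrier(1,2) st] mult_mat_index_sum[OF dims kj(2,4)]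
      using st by (simp add: block_col_def block_row_def)
    moreover have "M $$ (s, t) = 1 / (x ?k - y ?j) * (a ?k * b ?j) $$ (?u, ?v)"
      using st kj dims by (simp add: M_def block_mat_def del: index_mult_mat(1))
    \<comment> \<open>The two diagonal factors differ by (l - y j) - (l - x k) = x k - y j. This
      cancels the denominator of the block of \<open>M\<close> and eliminates
      \<open>l\<close>.\<close>
    moreover have "x ?k - y ?j \<noteq> 0" using ne kj by simp
    ultimately show ?case
      using st by (simp add: block_col_def block_row_def field_simps del: index_mult_mat(1))
  qed (simp_all add: block_col_def block_row_def)
qed

text \<open>Multiply \<open>disp\<close> by \<open>Si * K\<close> on the left and by
  \<open>K * Ti\<close> on the right. The term with \<open>S\<close> collapses to
  \<open>K * Ti\<close>, the one with \<open>T\<close> to \<open>Si * K\<close>, and the rank term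
  \<open>A * B\<close> stays between two copies of \<open>K\<close>.\<close>

lemma displacement_inverse:
  fixes A B K M :: "complex mat"
  assumes A: "A \<in> carrier_mat P n" and B: "B \<in> carrier_mat n P"
    and M: "M \<in> carrier_mat P P" and K: "K \<in> carrier_mat P P"
    and S: "S \<in> carrier_mat P P" "Si \<in> carrier_mat P P" "Si * S = 1\<^sub>m P"
    and T: "T \<in> carrier_mat P P" "Ti \<in> carrier_mat P P" "T * Ti = 1\<^sub>m P"
    and MK: "M * K = 1\<^sub>m P" "K * M = 1\<^sub>m P"
    and disp: "M * S = T * M + A * B"
  shows "K * Ti = Si * K + Si * (K * (A * (B * (K * Ti))))"
proof -
  note dims = A B M K S(1,2) T(1,2)
  note d = dims[THEN carrier_matD(1)] dims[THEN carrier_matD(2)]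
  have "Si * ((K * (M * S) * K) * Ti) = Si * ((K * (T * M + A * B) * K) * Ti)"
    by (simp only: disp)
  moreover have "Si * ((K * (M * S) * K) * Ti) = (Si * ((K * M) * S)) * (K * Ti)"
    by (simp add: mat_ring_dim d)
  moreover have "\<dots> = K * Ti" by (simp add: mat_ring_dim d MK S(3))
  moreover have "Si * ((K * (T * M + A * B) * K) * Ti) =
      Si * (K * (T * ((M * K) * Ti))) + Si * (K * (A * (B * (K * Ti))))"
    by (simp add: mat_ring_dim d)
  moreover have "Si * (K * (T * ((M * K) * Ti))) = Si * K"
    by (simp add: mat_ring_dim d MK T(3))
  ultimately show ?thesis by simp
qed

text \<open>Both follow from \<open>id\<close> multiplied by \<open>B\<close> on the left: with
  \<open>A\<close> on the right it shows that \<open>E\<close> inverts the bracket in the Darboux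
  matrix; with \<open>Ti * A\<close> on the right it evaluates \<open>E\<close> times the
  squared-pole term produced by differentiation.\<close>

lemma darboux_identities:
  fixes A B K :: "complex mat"
  assumes A: "A \<in> carrier_mat P n" and B: "B \<in> carrier_mat n P" and K: "K \<in> carrier_mat P P"
    and Si: "Si \<in> carrier_mat P P" and Ti: "Ti \<in> carrier_mat P P"
    and id: "K * Ti = Si * K + Si * (K * (A * (B * (K * Ti))))"
  defines "E \<equiv> 1\<^sub>m n - B * (Si * K) * A"
  shows "E * (1\<^sub>m n + B * (K * Ti) * A) = 1\<^sub>m n"
    and "E * (B * (K * (Ti * Ti)) * A) = B * (Si * K * Ti) * A"
proof -
  note dims = A B K Si Ti
  note d = dims[THEN carrier_matD(1)] dims[THEN carrier_matD(2)]
  have "B * ((K * Ti) * A) = B * ((Si * K + Si * (K * (A * (B * (K * Ti))))) * A)"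
    by (subst id) (rule refl)
  then have 1: "B * (K * (Ti * A)) = B * (Si * (K * A)) + B * (Si * (K * (A * (B * (K * (Ti * A))))))"
    by (simp add: mat_ring_dim d)
  show "E * (1\<^sub>m n + B * (K * Ti) * A) = 1\<^sub>m n"
    unfolding E_def
    \<comment> \<open>After substitution only additive cancellation is left, which is done on
      entries because matrices of varying size are not an additive group type.\<close>
    by (simp add: mat_ring_dim d, subst 1, rule eq_matI)
      (simp_all add: d del: index_mult_mat(1))
  have "B * ((K * Ti) * (Ti * A)) = B * ((Si * K + Si * (K * (A * (B * (K * Ti))))) * (Ti * A))"
    by (subst id) (rule refl)
  then have 2: "B * (K * (Ti * (Ti * A))) =
      B * (Si * (K * (Ti * A))) + B * (Si * (K * (A * (B * (K * (Ti * (Ti * A)))))))"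
    by (simp add: mat_ring_dim d)
  show "E * (B * (K * (Ti * Ti)) * A) = B * (Si * K * Ti) * A"
    unfolding E_def
    by (simp add: mat_ring_dim d, subst 2, rule eq_matI)
      (simp_all add: d del: index_mult_mat(1))
qed

section \<open>Entrywise sums and complex derivatives of matrices\<close>

lemma sum_mats_carrier [simp]: "sum_mats n f I \<in> carrier_mat n n"
  by (simp add: sum_mats_def)

lemma sum_mats_cong: "(\<And>i. i \<in> I \<Longrightarrow> f i = g i) \<Longrightarrow> sum_mats n f I = sum_mats n g I"
  by (simp add: sum_mats_def)

text \<open>The Darboux matrix sums over (k, j), the surface formula over (j, k).\<close>

lemma sum_mats_swap:
  "sum_mats n (\<lambda>(k, j). f j k) (I \<times> J) = sum_mats n (\<lambda>(j, k). f j k) (J \<times> I)"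
  unfolding sum_mats_def
  by (rule cong_mat) (auto simp: case_prod_unfold intro!: sum.reindex_bij_witness[of _ prod.swap prod.swap])

lemma mult_sum_mats:
  assumes "V \<in> carrier_mat n n" "W \<in> carrier_mat n n" "\<And>i. i \<in> I \<Longrightarrow> f i \<in> carrier_mat n n"
  shows "sum_mats n (\<lambda>i. V * f i * W) I = V * sum_mats n f I * W"
proof (rule eq_matI)
  fix r c assume "r < dim_row (V * sum_mats n f I * W)" "c < dim_col (V * sum_mats n f I * W)"
  then have rc: "r < n" "c < n" using assms by auto
  have "(V * sum_mats n f I * W) $$ (r, c) =
      (\<Sum>u<n. \<Sum>v<n. V $$ (r, u) * (\<Sum>i\<in>I. f i $$ (u, v)) * W $$ (v, c))"
    by (subst mult3_mat_index_sum[OF assms(1) sum_mats_carrier assms(2) rc]) (simp add: sum_mats_def)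
  also have "\<dots> = (\<Sum>i\<in>I. \<Sum>u<n. \<Sum>v<n. V $$ (r, u) * f i $$ (u, v) * W $$ (v, c))"
    by (simp add: sum_distrib_left sum_distrib_right sum.swap[of _ I])
  also have "\<dots> = sum_mats n (\<lambda>i. V * f i * W) I $$ (r, c)"
    using rc assms by (auto simp: sum_mats_def mult3_mat_index_sum[OF assms(1) _ assms(2) rc]
        simp del: index_mult_mat(1) intro!: sum.cong)
  finally show "sum_mats n (\<lambda>i. V * f i * W) I $$ (r, c) = (V * sum_mats n f I * W) $$ (r, c)" by simp
qed (use assms in \<open>auto simp: sum_mats_def\<close>)

text \<open>\<open>deriv_mat\<close> is total and asserts no differentiability. The relational form
  carries existence, as the product rule requires.\<close>

definition has_deriv_mat ::
    "nat \<Rightarrow> (complex \<Rightarrow> complex mat) \<Rightarrow> complex mat \<Rightarrow> complex \<Rightarrow> bool" where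
  "has_deriv_mat n f f' z \<longleftrightarrow> f' \<in> carrier_mat n n \<and> (\<forall>r<n. \<forall>c<n.
     ((\<lambda>w. f w $$ (r, c)) has_field_derivative f' $$ (r, c)) (at z))"

lemma has_deriv_mat_imp_deriv_mat: "has_deriv_mat n f f' z \<Longrightarrow> deriv_mat n f z = f'"
  unfolding has_deriv_mat_def deriv_mat_def by (intro eq_matI) (auto simp: DERIV_imp_deriv)

lemma has_deriv_mat_mult:
  assumes f: "has_deriv_mat n f f' z" and g: "has_deriv_mat n g g' z"
    and "open S" "z \<in> S"
    and fS: "\<And>w. w \<in> S \<Longrightarrow> f w \<in> carrier_mat n n" and gS: "\<And>w. w \<in> S \<Longrightarrow> g w \<in> carrier_mat n n"
  shows "has_deriv_mat n (\<lambda>w. f w * g w) (f' * g z + f z * g') z"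
  unfolding has_deriv_mat_def
proof (intro conjI allI impI)
  have f': "f' \<in> carrier_mat n n" and g': "g' \<in> carrier_mat n n"
    using f g by (auto simp: has_deriv_mat_def)
  note z = fS[OF \<open>z \<in> S\<close>] gS[OF \<open>z \<in> S\<close>]
  show "f' * g z + f z * g' \<in> carrier_mat n n" using f' g' z by auto
  fix r c assume rc: "r < n" "c < n"
  have "((\<lambda>w. \<Sum>i<n. f w $$ (r, i) * g w $$ (i, c)) has_field_derivative
      (\<Sum>i<n. f' $$ (r, i) * g z $$ (i, c) + g' $$ (i, c) * f z $$ (r, i))) (at z)"
    using f g rc by (intro derivative_intros DERIV_mult) (auto simp: has_deriv_mat_def)
  moreover have "(\<Sum>i<n. f' $$ (r, i) * g z $$ (i, c) + g' $$ (i, c) * f z $$ (r, i)) =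
      (f' * g z + f z * g') $$ (r, c)"
    using rc f' g' z mult_mat_index_sum[OF f' z(2) rc] mult_mat_index_sum[OF z(1) g' rc]
    by (simp add: sum.distrib mult_ac del: index_mult_mat(1))
  ultimately have "((\<lambda>w. \<Sum>i<n. f w $$ (r, i) * g w $$ (i, c)) has_field_derivative
      (f' * g z + f z * g') $$ (r, c)) (at z)"
    by (simp only:)
  then show "((\<lambda>w. (f w * g w) $$ (r, c)) has_field_derivative
      (f' * g z + f z * g') $$ (r, c)) (at z)"
    \<comment> \<open>The sum formula for entries of the product needs the right dimensions, which
      are known only on \<open>S\<close>; openness of \<open>S\<close> makes this enough.\<close>
    by (rule has_field_derivative_transform_within_open[OF _ \<open>open S\<close> \<open>z \<in> S\<close>])
      (simp add: mult_mat_index_sum[OF fS gS rc] del: index_mult_mat(1))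
qed

section \<open>The soliton surface after the Darboux transformation\<close>

theorem theorem5p5:
  fixes n N :: nat
    and X :: "(real ^ 'm::finite) set"
    and \<Omega> :: "((real ^ 'm) \<times> complex) set"
    and Z :: "complex set"
    and isospectral :: bool
    and L :: "'m \<Rightarrow> real ^ 'm \<Rightarrow> complex \<Rightarrow> complex"
    and \<Lambda> :: "real ^ 'm \<Rightarrow> complex \<Rightarrow> complex"
    and U :: "'m \<Rightarrow> real ^ 'm \<Rightarrow> complex \<Rightarrow> complex mat"
    and \<Psi> \<Psi>t D :: "real ^ 'm \<Rightarrow> complex \<Rightarrow> complex mat"
    and lam mu :: "nat \<Rightarrow> real ^ 'm \<Rightarrow> complex"
    and p q :: "nat \<Rightarrow> nat"
    and a0 b0 :: "nat \<Rightarrow> complex mat"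
    and a b :: "nat \<Rightarrow> real ^ 'm \<Rightarrow> complex mat"
    and M K :: "nat \<Rightarrow> nat \<Rightarrow> real ^ 'm \<Rightarrow> complex mat"
    and Mhat Nrm :: "real ^ 'm \<Rightarrow> complex mat"
    and F Ft :: "real ^ 'm \<Rightarrow> complex \<Rightarrow> complex mat"
  assumes X: "open X"
    and \<Omega>: "open \<Omega>" "\<Omega> \<subseteq> X \<times> UNIV"
    and Z: "open Z"
    and L_rational: "\<not> isospectral \<Longrightarrow> \<forall>\<nu>. \<forall>x\<in>X. rational_on (L \<nu> x) {l. (x, l) \<in> \<Omega>}"
    and \<Lambda>_iso: "isospectral \<Longrightarrow> \<forall>x\<in>X. \<forall>\<zeta>\<in>Z. \<Lambda> x \<zeta> = \<zeta>"
    and \<Lambda>_spectral: "\<forall>\<zeta>\<in>Z. spectral_parameter isospectral L X (\<lambda>x. \<Lambda> x \<zeta>)"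
    and \<Lambda>_holomorphic: "\<forall>x\<in>X. \<Lambda> x holomorphic_on Z"
    and \<Lambda>_domain: "\<forall>x\<in>X. \<forall>\<zeta>\<in>Z. (x, \<Lambda> x \<zeta>) \<in> \<Omega>"
    and U_carrier: "\<forall>\<nu>. \<forall>(x, l)\<in>\<Omega>. U \<nu> x l \<in> carrier_mat n n"
    and U_rational: "\<forall>\<nu>. \<forall>x\<in>X. \<forall>r<n. \<forall>c<n.
           rational_on (\<lambda>l. U \<nu> x l $$ (r, c)) {l. (x, l) \<in> \<Omega>}"
    and \<Psi>_carrier: "\<forall>(x, l)\<in>\<Omega>. \<Psi> x l \<in> carrier_mat n n"
    and \<Psi>_invertible: "\<forall>(x, l)\<in>\<Omega>. invertible_mat (\<Psi> x l)"
    and \<Psi>_regular: "\<forall>x\<in>X. \<forall>r<n. \<forall>c<n.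
           (\<lambda>l. \<Psi> x l $$ (r, c)) holomorphic_on {l. (x, l) \<in> \<Omega>}"
    and \<Psi>_linear: "linear_problem n isospectral L X \<Omega> U \<Psi>"
    and lam_spectral: "\<forall>k<N. spectral_parameter isospectral L X (lam k)"
    and mu_spectral: "\<forall>k<N. spectral_parameter isospectral L X (mu k)"
    and lam_domain: "\<forall>k<N. \<forall>x\<in>X. (x, lam k x) \<in> \<Omega>"
    and mu_domain: "\<forall>k<N. \<forall>x\<in>X. (x, mu k x) \<in> \<Omega>"
    and lam_distinct: "\<forall>x\<in>X. inj_on (\<lambda>k. lam k x) {..<N}"
    and mu_distinct: "\<forall>x\<in>X. inj_on (\<lambda>k. mu k x) {..<N}"
    and lam_mu_distinct: "\<forall>x\<in>X. \<forall>k<N. \<forall>j<N. lam k x \<noteq> mu j x"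
    and a0: "\<forall>k<N. a0 k \<in> carrier_mat (p k) n \<and> lin_indep_rows (a0 k)"
    and b0: "\<forall>k<N. b0 k \<in> carrier_mat n (q k) \<and> lin_indep_cols (b0 k)"
    and a: "\<And>k x. a k x = a0 k * mat_inv (\<Psi> x (lam k x))"
    and b: "\<And>k x. b k x = \<Psi> x (mu k x) * b0 k"
    and M: "\<And>k j x. M k j x = (1 / (lam k x - mu j x)) \<cdot>\<^sub>m (a k x * b j x)"
    and Mhat: "\<And>x. Mhat x = block_mat N p q (\<lambda>k j. M k j x)"
    and Mhat_invertible: "\<forall>x\<in>X. invertible_mat (Mhat x)"
    and K: "\<And>j k x. K j k x = block_of q p (mat_inv (Mhat x)) j k"
    and Nrm: "\<forall>x\<in>X. Nrm x \<in> carrier_mat n n \<and> invertible_mat (Nrm x)"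
    and D: "\<And>x l. D x l = Nrm x * (1\<^sub>m n +
           sum_mats n (\<lambda>(k, j). (1 / (l - lam k x)) \<cdot>\<^sub>m (b j x * K j k x * a k x))
             ({..<N} \<times> {..<N}))"
    and \<Psi>t: "\<And>x l. \<Psi>t x l = D x l * \<Psi> x l"
    and F: "\<And>x \<zeta>. F x \<zeta> =
           mat_inv (\<Psi> x (\<Lambda> x \<zeta>)) * deriv_mat n (\<lambda>z. \<Psi> x (\<Lambda> x z)) \<zeta>"
    and Ft: "\<And>x \<zeta>. Ft x \<zeta> =
           mat_inv (\<Psi>t x (\<Lambda> x \<zeta>)) * deriv_mat n (\<lambda>z. \<Psi>t x (\<Lambda> x z)) \<zeta>"
  shows "\<forall>x\<in>X. \<forall>\<zeta>\<in>Z.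
           (\<forall>k<N. \<Lambda> x \<zeta> \<noteq> lam k x \<and> \<Lambda> x \<zeta> \<noteq> mu k x) \<longrightarrow>
           Ft x \<zeta> = F x \<zeta> - deriv (\<Lambda> x) \<zeta> \<cdot>\<^sub>m
             sum_mats n (\<lambda>(j, k). (1 / ((\<Lambda> x \<zeta> - lam k x) * (\<Lambda> x \<zeta> - mu j x))) \<cdot>\<^sub>m
                 (mat_inv (\<Psi> x (\<Lambda> x \<zeta>)) * b j x * K j k x * a k x * \<Psi> x (\<Lambda> x \<zeta>)))
               ({..<N} \<times> {..<N})"
proof (intro ballI impI)
  fix x \<zeta>
  assume x: "x \<in> X" and \<zeta>: "\<zeta> \<in> Z"
    and ne: "\<forall>k<N. \<Lambda> x \<zeta> \<noteq> lam k x \<and> \<Lambda> x \<zeta> \<noteq> mu k x"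
  define l where "l = \<Lambda> x \<zeta>"
  define P where "P = block_offset p N"
  define Q where "Q = block_offset q N"
  define A where "A = block_col N p n (\<lambda>k. a k x)"
  define B where "B = block_row n N q (\<lambda>j. b j x)"
  define Kh where "Kh = mat_inv (Mhat x)"
  define Tinv where "Tinv = (\<lambda>w. block_diag N p (\<lambda>k. 1 / (w - lam k x)))"
  define Sinv where "Sinv = block_diag N q (\<lambda>j. 1 / (l - mu j x))"
  define Ni where "Ni = mat_inv (Nrm x)"
  define W where "W = \<Psi> x l"
  define Wi where "Wi = mat_inv W"
  define W' where "W' = deriv_mat n (\<lambda>z. \<Psi> x (\<Lambda> x z)) \<zeta>"

  have \<Psi>_car: "\<Psi> x (\<Lambda> x z) \<in> carrier_mat n n" if "z \<in> Z" for z
    using \<Psi>_carrier \<Lambda>_domain x that by auto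
  have W: "W \<in> carrier_mat n n" "Wi \<in> carrier_mat n n" "Wi * W = 1\<^sub>m n"
    using mat_inv_works[of W n] \<Psi>_carrier \<Psi>_invertible \<Lambda>_domain x \<zeta>
    unfolding W_def Wi_def l_def by auto
  have N: "Nrm x \<in> carrier_mat n n" "Ni \<in> carrier_mat n n" "Ni * Nrm x = 1\<^sub>m n"
    using mat_inv_works[of "Nrm x" n] Nrm x unfolding Ni_def by auto

  have a_car: "a k x \<in> carrier_mat (p k) n" if "k < N" for k
  proof -
    have "mat_inv (\<Psi> x (lam k x)) \<in> carrier_mat n n"
      using mat_inv_works(1)[of "\<Psi> x (lam k x)" n] \<Psi>_carrier \<Psi>_invertible lam_domain x that by auto
    then show ?thesis using a0 that by (auto simp: a)
  qed
  have b_car: "b j x \<in> carrier_mat n (q j)" if "j < N" for j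
    using \<Psi>_carrier mu_domain b0 x that by (fastforce simp: b)

  have M_car: "Mhat x \<in> carrier_mat P Q" by (simp add: Mhat P_def Q_def)
  \<comment> \<open>Individual blocks may be rectangular; invertibility of \<open>Mhat x\<close>
    only forces the total height and width to agree.\<close>
  have PQ: "Q = P"
    using Mhat_invertible x M_car by (auto simp: invertible_mat_def)
  have MK: "Kh \<in> carrier_mat P P" "Mhat x * Kh = 1\<^sub>m P" "Kh * Mhat x = 1\<^sub>m P"
    using mat_inv_works[of "Mhat x" P] M_car Mhat_invertible x unfolding Kh_def PQ by auto
  have Kb: "K j k x = block_of q p Kh j k" for j k by (simp add: K Kh_def)
  have car: "A \<in> carrier_mat P n" "B \<in> carrier_mat n P" "Tinv w \<in> carrier_mat P P"
    "Sinv \<in> carrier_mat P P" for w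
    using block_carrier PQ unfolding A_def B_def Tinv_def Sinv_def P_def Q_def by metis+

  have residue_sum: "sum_mats n (\<lambda>(j, k). (g j * f k) \<cdot>\<^sub>m (b j x * K j k x * a k x)) ({..<N} \<times> {..<N}) =
      B * (block_diag N q g * Kh * block_diag N p f) * A" for f g
    unfolding A_def B_def Kb
    by (intro sum_mats_blocks b_car a_car) (use MK PQ in \<open>auto simp: P_def Q_def\<close>)
  \<comment> \<open>\<open>D\<close> has poles at the \<open>lam k\<close> only, so its weights are
    the case of trivial factors on the \<open>j\<close> side.\<close>
  have diag_one: "block_diag N q (\<lambda>_. 1) = 1\<^sub>m P"
    using PQ by (simp add: block_diag_def Q_def)
  have residue_sum_lam: "sum_mats n (\<lambda>(k, j). f k \<cdot>\<^sub>m (b j x * K j k x * a k x)) ({..<N} \<times> {..<N}) =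
      B * (Kh * block_diag N p f) * A" for f
    using residue_sum[of "\<lambda>_. 1" f] MK(1) diag_one
    by (subst sum_mats_swap) simp

  \<comment> \<open>The assumption \<open>ne\<close> keeps \<open>l\<close> away from all
    \<open>lam k\<close> and \<open>mu j\<close>, so \<open>Tinv l\<close> and \<open>Sinv\<close>
    really are inverses.\<close>
  have id: "Kh * Tinv l = Sinv * Kh + Sinv * (Kh * (A * (B * (Kh * Tinv l))))"
  proof (rule displacement_inverse)
    show "Sinv * block_diag N q (\<lambda>j. l - mu j x) = 1\<^sub>m P"
      using ne PQ unfolding Sinv_def l_def Q_def
      by (subst block_diag_inverse) auto
    show "block_diag N p (\<lambda>k. l - lam k x) * Tinv l = 1\<^sub>m P"
      using ne unfolding Tinv_def l_def P_def
      by (subst block_diag_inverse) auto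
    show "Mhat x * block_diag N q (\<lambda>j. l - mu j x) =
        block_diag N p (\<lambda>k. l - lam k x) * Mhat x + A * B"
      unfolding Mhat M A_def B_def
      by (rule block_displacement) (use a_car b_car lam_mu_distinct x in auto)
    show "block_diag N q (\<lambda>j. l - mu j x) \<in> carrier_mat P P"
      using block_carrier(3)[of N q] PQ unfolding Q_def by simp
    show "block_diag N p (\<lambda>k. l - lam k x) \<in> carrier_mat P P"
      unfolding P_def by simp
  qed (use car MK M_car PQ in auto)

  \<comment> \<open>\<open>R\<close> is the bracket of \<open>D\<close> at \<open>l\<close>,
    \<open>E\<close> its inverse, and \<open>- G\<close> its derivative in the spectral
    parameter.\<close>
  define E where "E = 1\<^sub>m n - B * (Sinv * Kh) * A"
  define R where "R = 1\<^sub>m n + B * (Kh * Tinv l) * A"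
  define G where "G = B * (Kh * (Tinv l * Tinv l)) * A"
  have E: "E * R = 1\<^sub>m n" "E * G = B * (Sinv * Kh * Tinv l) * A"
    using darboux_identities[OF car(1,2) MK(1) car(4,3) id] unfolding E_def R_def G_def by auto
  have ERG: "E \<in> carrier_mat n n" "R \<in> carrier_mat n n" "G \<in> carrier_mat n n"
    using car MK unfolding E_def R_def G_def by auto

  have D_car: "D x w \<in> carrier_mat n n" for w
    using N by (simp add: D)
  have Dl: "D x l = Nrm x * R"
    unfolding D residue_sum_lam R_def Tinv_def ..
  have \<Psi>tl: "\<Psi>t x l = Nrm x * R * W" by (simp add: \<Psi>t Dl W_def)

  define d where "d = deriv (\<Lambda> x) \<zeta>"
  have \<Lambda>': "(\<Lambda> x has_field_derivative d) (at \<zeta>)"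
    unfolding d_def using \<Lambda>_holomorphic x \<zeta> Z by (auto intro: holomorphic_derivI)

  have dW: "has_deriv_mat n (\<lambda>z. \<Psi> x (\<Lambda> x z)) W' \<zeta>"
    unfolding has_deriv_mat_def
  proof (intro conjI allI impI)
    fix r c assume rc: "r < n" "c < n"
    \<comment> \<open>The slice of \<Omega> at fixed \<open>x\<close> is open, so holomorphy there
      gives differentiability at \<Lambda> x \<zeta>. The value \<open>W'\<close> is then correct
      because it is defined through \<open>deriv\<close>.\<close>
    have "open ((\<lambda>l. (x, l)) -` \<Omega>)"
      using \<Omega>(1) by (intro open_vimage continuous_intros)
    then have op: "open {l. (x, l) \<in> \<Omega>}" by (simp add: vimage_def)
    have "(\<lambda>l. \<Psi> x l $$ (r, c)) field_differentiable at (\<Lambda> x \<zeta>)"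
      by (rule holomorphic_on_imp_differentiable_at[OF _ op]) (use \<Psi>_regular x \<zeta> rc \<Lambda>_domain in auto)
    moreover have "\<Lambda> x field_differentiable at \<zeta>"
      using \<Lambda>' field_differentiable_def by blast
    ultimately have "(\<lambda>z. \<Psi> x (\<Lambda> x z) $$ (r, c)) field_differentiable at \<zeta>"
      using field_differentiable_compose[of "\<Lambda> x" \<zeta> "\<lambda>l. \<Psi> x l $$ (r, c)"] by (simp add: o_def)
    then show "((\<lambda>z. \<Psi> x (\<Lambda> x z) $$ (r, c)) has_field_derivative W' $$ (r, c)) (at \<zeta>)"
      using rc by (simp add: W'_def deriv_mat_def field_differentiable_derivI)
  qed (simp add: W'_def deriv_mat_def)

  have dS: "has_deriv_mat n (\<lambda>z. 1\<^sub>m n + sum_mats n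
      (\<lambda>(k, j). (1 / (\<Lambda> x z - lam k x)) \<cdot>\<^sub>m (b j x * K j k x * a k x)) ({..<N} \<times> {..<N})) (- d \<cdot>\<^sub>m G) \<zeta>"
    unfolding has_deriv_mat_def
  proof (intro conjI allI impI)
    fix r c assume rc: "r < n" "c < n"
    let ?C = "\<lambda>j k. b j x * K j k x * a k x"
    have dims: "dim_row (?C j k) = n" "dim_col (?C j k) = n" if "j < N" "k < N" for j k
      using a_car[of k] b_car[of j] that by auto
    have "G = sum_mats n (\<lambda>(k, j). (1 / (l - lam k x) * (1 / (l - lam k x))) \<cdot>\<^sub>m ?C j k) ({..<N} \<times> {..<N})"
      unfolding residue_sum_lam G_def Tinv_def block_diag_mult ..
    then have G': "G $$ (r, c) = (\<Sum>(k, j)\<in>{..<N} \<times> {..<N}. 1 / (l - lam k x)\<^sup>2 * ?C j k $$ (r, c))"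
      using rc dims by (auto simp: sum_mats_def power2_eq_square case_prod_unfold
        simp del: index_mult_mat(1) intro!: sum.cong)
    \<comment> \<open>Only the scalar weights depend on \<zeta>; the chain rule turns each simple
      pole into \<open>- d\<close> times its square.\<close>
    have "((\<lambda>z. 1\<^sub>m n $$ (r, c) + (\<Sum>i\<in>{..<N} \<times> {..<N}. 1 / (\<Lambda> x z - lam (fst i) x) * ?C (snd i) (fst i) $$ (r, c)))
        has_field_derivative (0 + (\<Sum>i\<in>{..<N} \<times> {..<N}. - (d / (l - lam (fst i) x)\<^sup>2) * ?C (snd i) (fst i) $$ (r, c)))) (at \<zeta>)"
      unfolding l_def using ne
      by (intro DERIV_add DERIV_const DERIV_sum DERIV_cmult_right)
        (auto intro!: derivative_eq_intros \<Lambda>' simp: power2_eq_square)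
    moreover have "(\<Sum>i\<in>{..<N} \<times> {..<N}. - (d / (l - lam (fst i) x)\<^sup>2) * ?C (snd i) (fst i) $$ (r, c))
        = (- d \<cdot>\<^sub>m G) $$ (r, c)"
      using rc ERG by (simp add: G' sum_distrib_left case_prod_unfold sum_negf)
    moreover have "(1\<^sub>m n + sum_mats n (\<lambda>(k, j). (1 / (\<Lambda> x z - lam k x)) \<cdot>\<^sub>m ?C j k) ({..<N} \<times> {..<N})) $$ (r, c)
        = 1\<^sub>m n $$ (r, c) + (\<Sum>i\<in>{..<N} \<times> {..<N}. 1 / (\<Lambda> x z - lam (fst i) x) * ?C (snd i) (fst i) $$ (r, c))" for z
      using rc dims by (auto simp: sum_mats_def case_prod_unfold
        simp del: index_mult_mat(1) intro!: sum.cong)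
    ultimately show "((\<lambda>z. (1\<^sub>m n + sum_mats n (\<lambda>(k, j). (1 / (\<Lambda> x z - lam k x)) \<cdot>\<^sub>m ?C j k)
        ({..<N} \<times> {..<N})) $$ (r, c)) has_field_derivative (- d \<cdot>\<^sub>m G) $$ (r, c)) (at \<zeta>)"
      by simp
  qed (use ERG in simp)

  have const: "has_deriv_mat n (\<lambda>z. Nrm x) (0\<^sub>m n n) \<zeta>"
    by (simp add: has_deriv_mat_def)
  have "Nrm x * (- d \<cdot>\<^sub>m G) \<in> carrier_mat n n" using N ERG by simp
  then have drop: "0\<^sub>m n n * (1\<^sub>m n + sum_mats n f I) + Nrm x * (- d \<cdot>\<^sub>m G) = Nrm x * (- d \<cdot>\<^sub>m G)"
    for f :: "nat \<times> nat \<Rightarrow> complex mat" and I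
    by (subst left_mult_zero_mat[of _ n n]) simp_all
  have dD: "has_deriv_mat n (\<lambda>z. D x (\<Lambda> x z)) (Nrm x * (- d \<cdot>\<^sub>m G)) \<zeta>"
    unfolding D
    by (rule has_deriv_mat_mult[OF const dS Z \<zeta>, unfolded drop]) (use N in simp_all)
  from has_deriv_mat_mult[OF dD dW Z \<zeta>]
  have "has_deriv_mat n (\<lambda>z. \<Psi>t x (\<Lambda> x z)) (Nrm x * (- d \<cdot>\<^sub>m G) * W + Nrm x * R * W') \<zeta>"
    using D_car \<Psi>_car by (simp add: \<Psi>t Dl flip: W_def l_def)
  note dPsit = has_deriv_mat_imp_deriv_mat[OF this]

  have W'_car: "W' \<in> carrier_mat n n" by (simp add: W'_def deriv_mat_def)
  note cars = W(1,2) N(1,2) ERG W'_car car MK(1)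
  note dm = cars[THEN carrier_matD(1)] cars[THEN carrier_matD(2)]
  \<comment> \<open>The factors of the transformed solution are inverted in reverse order, and the
    left product telescopes.\<close>
  have inv: "mat_inv (\<Psi>t x l) = Wi * E * Ni"
  proof (rule mat_inv_eqI)
    have "Wi * E * Ni * \<Psi>t x l = Wi * (E * ((Ni * Nrm x) * (R * W)))"
      unfolding \<Psi>tl by (simp add: mult_mat_assoc_dim dm)
    also have "\<dots> = Wi * ((E * R) * W)"
      unfolding N(3) by (simp add: mat_ring_dim dm)
    also have "\<dots> = 1\<^sub>m n"
      unfolding E(1) using W by (simp add: mat_ring_dim dm)
    finally show "Wi * E * Ni * \<Psi>t x l = 1\<^sub>m n" .
  qed (auto simp: \<Psi>tl dm intro!: carrier_matI)

  have "Ft x \<zeta> = Wi * E * Ni * (Nrm x * (- d \<cdot>\<^sub>m G) * W + Nrm x * R * W')"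
    unfolding Ft dPsit inv[unfolded l_def] ..
  \<comment> \<open>The normalization cancels in both terms. The first becomes the conjugated
    logarithmic derivative of \<open>D\<close>, the second reduces to \<open>F\<close>.\<close>
  also have "\<dots> = Wi * (E * ((Ni * Nrm x) * ((- d \<cdot>\<^sub>m G) * W))) + Wi * (E * ((Ni * Nrm x) * (R * W')))"
    by (simp add: mult_mat_assoc_dim mult_mat_add_distrib_dim dm)
  also have "\<dots> = - d \<cdot>\<^sub>m (Wi * (E * G) * W) + Wi * ((E * R) * W')"
    unfolding N(3) by (simp add: mat_ring_dim dm)
  also have "\<dots> = Wi * W' - d \<cdot>\<^sub>m (Wi * (E * G) * W)"
    unfolding E(1) by (rule eq_matI) (simp_all add: dm one_mult_mat_dim del: index_mult_mat(1))
  also have "Wi * W' = F x \<zeta>"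
    by (simp add: F W'_def Wi_def W_def l_def)
  \<comment> \<open>\<open>E * G\<close> has \<open>Sinv\<close> and \<open>Tinv l\<close> on the
    two sides of \<open>Kh\<close>, hence product weights: it is again a double sum, into which the
    conjugation by \<open>W\<close> is moved.\<close>
  also have "Wi * (E * G) * W = sum_mats n (\<lambda>(j, k). (1 / ((l - lam k x) * (l - mu j x))) \<cdot>\<^sub>m
      (Wi * b j x * K j k x * a k x * W)) ({..<N} \<times> {..<N})"
  proof -
    let ?f = "\<lambda>(j, k). (1 / (l - mu j x) * (1 / (l - lam k x))) \<cdot>\<^sub>m (b j x * K j k x * a k x)"
    have "Wi * (E * G) * W = Wi * sum_mats n ?f ({..<N} \<times> {..<N}) * W"
      unfolding E(2) residue_sum Sinv_def Tinv_def ..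
    also have "\<dots> = sum_mats n (\<lambda>i. Wi * ?f i * W) ({..<N} \<times> {..<N})"
      using W a_car[THEN carrier_matD(2)] b_car[THEN carrier_matD(1)]
      by (intro mult_sum_mats[symmetric]) (auto intro!: carrier_matI)
    also have "\<dots> = sum_mats n (\<lambda>(j, k). (1 / ((l - lam k x) * (l - mu j x))) \<cdot>\<^sub>m
        (Wi * b j x * K j k x * a k x * W)) ({..<N} \<times> {..<N})"
    proof (intro sum_mats_cong, clarsimp)
      fix j k assume jk: "j < N" "k < N"
      have "dim_row (K j k x) = q j" "dim_col (K j k x) = p k"
        by (simp_all add: K block_of_def)
      moreover note a_car[OF jk(2), THEN carrier_matD(1)] a_car[OF jk(2), THEN carrier_matD(2)]
        b_car[OF jk(1), THEN carrier_matD(1)] b_car[OF jk(1), THEN carrier_matD(2)]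
      ultimately show "Wi * (1 / ((l - mu j x) * (l - lam k x)) \<cdot>\<^sub>m (b j x * K j k x * a k x)) * W =
          1 / ((l - lam k x) * (l - mu j x)) \<cdot>\<^sub>m (Wi * b j x * K j k x * a k x * W)"
        by (simp add: mat_ring_dim dm mult.commute)
    qed
    finally show ?thesis .
  qed
  finally show "Ft x \<zeta> = F x \<zeta> - deriv (\<Lambda> x) \<zeta> \<cdot>\<^sub>m
             sum_mats n (\<lambda>(j, k). (1 / ((\<Lambda> x \<zeta> - lam k x) * (\<Lambda> x \<zeta> - mu j x))) \<cdot>\<^sub>m
                 (mat_inv (\<Psi> x (\<Lambda> x \<zeta>)) * b j x * K j k x * a k x * \<Psi> x (\<Lambda> x \<zeta>)))
               ({..<N} \<times> {..<N})"
    unfolding l_def Wi_def W_def d_def .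
qed

end
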